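(* Let $f(x),g(x)\in\mathbb{Z}[x]$ be polynomials of positive degree having no common complex root, and let $d=\gcd(L(f),L(g))$. Then there exists a non-negative integer $k$ such that $B(f,g)\mid d^k\, r(f,g)$.
   Context: $L(h)$ denotes the leading coefficient of $h\in\mathbb{Z}[x]$. There are unique $p,q\in\mathbb{Q}[x]$ with $pf+qg=1$, $\deg p<\deg g$, $\deg q<\deg f$; $B(f,g)$ is the least common multiple of the denominators (in lowest terms) of all coefficients of these $p$ and $q$. $r(f,g)$ (the reduced resultant) is the smallest positive integer in the set $\{p(x)f(x)+q(x)g(x): p,q\in\mathbb{Z}[x]\}$. *)

theory Defs
  imports Complex_Main "HOL-Computational_Algebra.Polynomial"
begin

text \<open>The pair exists and is unique whenever \<open>f\<close> and \<open>g\<close> have positive degree and no common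
complex root; outside that case the value is unspecified. The degree bounds also admit zero
polynomials, whose \<open>degree\<close> is \<open>0\<close>.\<close>
definition bezout_pair :: "int poly \<Rightarrow> int poly \<Rightarrow> rat poly \<times> rat poly" where
  "bezout_pair f g = (THE (p, q).
     p * map_poly of_int f + q * map_poly of_int g = 1 \<and>
     degree p < degree g \<and> degree q < degree f)"

text \<open>\<open>quotient_of\<close> returns lowest terms with positive denominator, so zero coefficients contribute
\<open>1\<close>.\<close>
definition denominator :: "rat \<Rightarrow> int" where
  "denominator x = snd (quotient_of x)"

definition bezout_denom :: "int poly \<Rightarrow> int poly \<Rightarrow> int" where
  "bezout_denom f g = (case bezout_pair f g of (p, q) \<Rightarrow>
     Lcm (denominator ` (set (coeffs p) \<union> set (coeffs q))))"

text \<open>Membership of an integer in the ideal \<open>(f, g)\<close> means membership of the constant polynomial.\<close>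
definition reduced_resultant :: "int poly \<Rightarrow> int poly \<Rightarrow> nat" where
  "reduced_resultant f g =
     (LEAST n. n > 0 \<and> (\<exists>p q :: int poly. p * f + q * g = [:int n:]))"

end

theory Submission
  imports
    Defs
    "HOL-Computational_Algebra.Field_as_Ring"
    "HOL-Computational_Algebra.Fundamental_Theorem_Algebra"
    "HOL-Computational_Algebra.Polynomial_Factorial"
begin

text \<open>Write \<open>r = u f + v g\<close> with integral \<open>u\<close>, \<open>v\<close> and \<open>1 = p f + q g\<close> with the rational pair of
small degree. Pseudo-division of \<open>v\<close> by \<open>f\<close> turns \<open>L(f)^m r\<close> into an integral combination whose
second coefficient has degree below \<open>deg f\<close>, so by uniqueness \<open>L(f)^m r p\<close> and \<open>L(f)^m r q\<close> are
integral. Symmetrically for a power of \<open>L(g)\<close>, and the denominators therefore divide the gcd of both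
multiples of \<open>r\<close>.\<close>

lemma map_poly_of_int_mult:
  "map_poly (of_int :: int \<Rightarrow> 'a :: {comm_ring_1, ring_char_0}) (p * q)
     = map_poly of_int p * map_poly of_int q"
  by (rule poly_eqI) (simp add: coeff_map_poly coeff_mult)

lemma map_poly_of_int_add:
  "map_poly (of_int :: int \<Rightarrow> 'a :: {comm_ring_1, ring_char_0}) (p + q)
     = map_poly of_int p + map_poly of_int q"
  by (rule poly_eqI) (simp add: coeff_map_poly)

lemma map_poly_of_rat_mult:
  "map_poly (of_rat :: rat \<Rightarrow> 'a :: field_char_0) (p * q) = map_poly of_rat p * map_poly of_rat q"
  by (rule poly_eqI) (simp add: coeff_map_poly coeff_mult of_rat_sum of_rat_mult)

lemma degree_map_poly_of_int:
  "degree (map_poly (of_int :: int \<Rightarrow> 'a :: {comm_ring_1, ring_char_0}) p) = degree p"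
  by (cases "p = 0") (simp_all add: degree_map_poly)

text \<open>With \<open>c = x / y\<close> in lowest terms the hypothesis reads
  \<open>N * x = M * y\<close>, so \<open>y\<close> divides \<open>N * x\<close> and, being coprime
  to \<open>x\<close>, divides \<open>N\<close>.\<close>

lemma denominator_dvd:
  assumes "of_int N * c = of_int M"
  shows "denominator c dvd N"
proof -
  obtain x y where xy: "quotient_of c = (x, y)" by (cases "quotient_of c")
  have y: "y > 0" and cop: "coprime x y" and c: "c = of_int x / of_int y"
    using quotient_of_denom_pos[OF xy] quotient_of_coprime[OF xy] quotient_of_div[OF xy] by auto
  have "of_int (N * x) = (of_int (M * y) :: rat)"
    using assms y unfolding c by (simp add: field_simps)
  then have "N * x = M * y" by (simp only: of_int_eq_iff)
  then have "y dvd N * x" by simp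
  then have "y dvd N" using cop by (simp add: coprime_commute coprime_dvd_mult_left_iff)
  then show ?thesis by (simp add: denominator_def xy)
qed

lemma Lcm_denominator_dvd:
  assumes "smult (of_int N) p = map_poly of_int P" "smult (of_int N) q = map_poly of_int Q"
  shows "Lcm (denominator ` (set (coeffs p) \<union> set (coeffs q))) dvd N"
proof (rule Lcm_least, clarify)
  have *: "denominator c dvd N"
    if h: "smult (of_int N) h = map_poly of_int H" and "c \<in> set (coeffs h)" for c h H
  proof -
    obtain i where "c = coeff h i" 
      using \<open>c \<in> set (coeffs h)\<close> range_coeff[of h] by blast
    moreover have "of_int N * coeff h i = of_int (coeff H i)"
      using arg_cong[OF h, of "\<lambda>p. coeff p i"] by (simp add: coeff_map_poly)
    ultimately show ?thesis by (auto intro: denominator_dvd)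
  qed
  fix c assume "c \<in> set (coeffs p) \<union> set (coeffs q)"
  then show "denominator c dvd N" using *[OF assms(1)] *[OF assms(2)] by blast
qed

text \<open>Serves to turn the rational Bezout identity into an integral one, which exhibits a
  positive integer in the ideal of \<open>f\<close> and \<open>g\<close>.\<close>

lemma clear_denominators:
  fixes p :: "rat poly"
  obtains N :: int and P where "N > 0" "smult (of_int N) p = map_poly of_int P"
proof -
  have "\<exists>N P. (N :: int) > 0 \<and> smult (of_int N) p = map_poly of_int P"
  proof (induction p)
    case 0
    show ?case by (rule exI[of _ 1], rule exI[of _ 0]) simp
  next
    case (pCons a p)
    then obtain N P where NP: "N > 0" "smult (of_int N) p = map_poly of_int P" by blast
    obtain x y where xy: "quotient_of a = (x, y)" by (cases "quotient_of a")
    have y: "y > 0" and a: "a = of_int x / of_int y"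
      using quotient_of_denom_pos[OF xy] quotient_of_div[OF xy] by auto
    have "smult (of_int (N * y)) p = smult (of_int y) (smult (of_int N) p)"
      by (simp add: mult.commute)
    also have "\<dots> = map_poly of_int (smult y P)"
      unfolding NP by (rule poly_eqI) (simp add: coeff_map_poly)
    finally have "smult (of_int (N * y)) (pCons a p) = map_poly of_int (pCons (N * x) (smult y P))"
      using y by (simp add: a map_poly_pCons)
    then show ?case using NP y by (intro exI[of _ "N * y"]) auto
  qed
  then show ?thesis using that by blast
qed

text \<open>\<open>F\<close> is coprime to \<open>G\<close> and divides \<open>E * G\<close>, hence
  divides \<open>E\<close>, which is too small in degree unless it vanishes. This gives uniqueness
  of the small pair and later identifies an integral combination with a multiple of it.\<close>

lemma bezout_homogeneous_zero:
  fixes F G :: "'a :: field poly"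
  assumes "p * F + q * G = 1" "D * F + E * G = 0" "degree E < degree F"
  shows "D = 0 \<and> E = 0"
proof -
  have "E = E * (p * F + q * G)" using assms by simp
  \<comment> \<open>The added middle term is zero; it trades \<open>E * q * G\<close> for a multiple
    of \<open>F\<close>.\<close>
  also have "\<dots> = E * p * F + q * (D * F + E * G) - q * D * F" by (simp add: algebra_simps)
  also have "\<dots> = F * (E * p - q * D)" using assms by (simp add: algebra_simps)
  finally have "F dvd E" by (rule dvdI)
  then have "E = 0" using assms(3) dvd_imp_degree_le[of F E] by force
  moreover from this have "D = 0" using assms by auto
  ultimately show ?thesis by blast
qed

text \<open>A common divisor over the rationals that is not a unit is zero or nonconstant, so it has
  a complex root, which \<open>f\<close> and \<open>g\<close> then share.\<close>

lemma coprime_map_poly_of_int: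
  assumes "\<not> (\<exists>z :: complex. poly (map_poly of_int f) z = 0 \<and> poly (map_poly of_int g) z = 0)"
  shows "coprime (map_poly rat_of_int f) (map_poly of_int g)"
proof (rule coprimeI, rule ccontr)
  fix h assume h: "h dvd map_poly rat_of_int f" "h dvd map_poly rat_of_int g"
    and "\<not> is_unit h"
  define H where "H = map_poly (of_rat :: rat \<Rightarrow> complex) h"
  have root: "poly (map_poly of_int e) z = 0"
    if dvd: "h dvd map_poly rat_of_int e" and z: "poly H z = 0" for e and z :: complex
  proof -
    obtain w where w: "map_poly rat_of_int e = h * w" using dvd by (elim dvdE)
    have "map_poly (of_int :: int \<Rightarrow> complex) e = map_poly of_rat (map_poly of_int e)"
      by (rule poly_eqI) (simp add: coeff_map_poly)
    then show ?thesis using z by (simp add: w map_poly_of_rat_mult H_def)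
  qed
  have "\<exists>z. poly H z = 0"
  proof (cases "h = 0")
    case False
    then have "degree H > 0"
      using \<open>\<not> is_unit h\<close> by (simp add: H_def degree_map_poly is_unit_iff_degree)
    then show ?thesis
      using fundamental_theorem_of_algebra[of H] by (simp add: constant_degree)
  qed (simp add: H_def)
  then show False using root h assms by blast
qed

text \<open>Reduce the second coefficient of any Bezout identity modulo \<open>F\<close> and absorb
  the quotient into the first. The bound on \<open>p\<close> is then automatic: otherwise
  \<open>p * F\<close> would have larger degree than \<open>q * G\<close>, and the sum could not be
  constant.\<close>

lemma ex_small_bezout:
  fixes F G :: "rat poly"
  assumes "coprime F G" "degree F > 0" "degree G > 0"
  shows "\<exists>p q. p * F + q * G = 1 \<and> degree p < degree G \<and> degree q < degree F"
proof -
  define a where "a = fst (bezout_coefficients F G)"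
  define b where "b = snd (bezout_coefficients F G)"
  have ab: "a * F + b * G = 1"
    using bezout_coefficients[of F G a b] assms(1) by (simp add: a_def b_def)
  define q where "q = b mod F"
  define p where "p = a + (b div F) * G"
  have "p * F + q * G = a * F + b * G"
    by (simp add: p_def q_def algebra_simps flip: minus_div_mult_eq_mod)
  then have eq: "p * F + q * G = 1" using ab by simp
  \<comment> \<open>A zero remainder is covered too: its degree is 0, and \<open>F\<close> has
    positive degree.\<close>
  have q: "degree q < degree F"
    using degree_mod_less[of F b] assms(2) by (cases "F = 0") (auto simp: q_def)
  have "degree p < degree G"
  proof (rule ccontr)
    assume "\<not> ?thesis"
    then have "p \<noteq> 0" and pG: "degree p \<ge> degree G" using assms by auto
    then have "degree (p * F) = degree p + degree F" using assms by (subst degree_mult_eq) auto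
    moreover have "degree (q * G) < degree p + degree F"
      using degree_mult_le[of q G] q pG by linarith
    ultimately have "degree (p * F + q * G) = degree p + degree F"
      by (simp add: degree_add_eq_left)
    then show False using eq assms by simp
  qed
  then show ?thesis using eq q by blast
qed

text \<open>Existence and uniqueness license unfolding the definite description; the difference of
  two candidate pairs solves the homogeneous equation.\<close>

lemma bezout_pair:
  assumes "degree f > 0" "degree g > 0"
    and "\<not> (\<exists>z :: complex. poly (map_poly of_int f) z = 0 \<and> poly (map_poly of_int g) z = 0)"
    and "bezout_pair f g = (p, q)"
  shows "p * map_poly of_int f + q * map_poly of_int g = 1 \<and>
    degree p < degree g \<and> degree q < degree f"
proof -
  let ?F = "map_poly rat_of_int f" and ?G = "map_poly rat_of_int g"
  let ?P = "\<lambda>(p, q). p * ?F + q * ?G = 1 \<and> degree p < degree g \<and> degree q < degree f"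
  have "\<exists>!z. ?P z"
  proof (rule ex_ex1I)
    show "\<exists>z. ?P z"
      using ex_small_bezout[OF coprime_map_poly_of_int[OF assms(3)]] assms(1,2)
      by (simp add: degree_map_poly_of_int)
  next
    fix z w assume zw: "?P z" "?P w"
    obtain p q p' q' where [simp]: "z = (p, q)" "w = (p', q')" by (cases z, cases w)
    have "p - p' = 0 \<and> q - q' = 0"
    proof (rule bezout_homogeneous_zero)
      show "p * ?F + q * ?G = 1" using zw by simp
      have "p * ?F + q * ?G = p' * ?F + q' * ?G" using zw by simp
      then show "(p - p') * ?F + (q - q') * ?G = 0" by (simp add: algebra_simps)
      show "degree (q - q') < degree ?F"
        using zw by (simp add: degree_map_poly_of_int degree_diff_less)
    qed
    then show "z = w" by simp
  qed
  from theI'[OF this] show ?thesis using assms(4) by (simp add: bezout_pair_def)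
qed

lemma integral_multiple_of_bezout:
  fixes f g u v :: "int poly" and n :: int
  assumes f: "degree f > 0"
    and pq: "p * map_poly of_int f + q * map_poly of_int g = (1 :: rat poly)" "degree q < degree f"
    and uv: "u * f + v * g = [:n:]"
  shows "\<exists>m P Q. smult (of_int (lead_coeff f ^ m * n)) p = map_poly of_int P \<and>
    smult (of_int (lead_coeff f ^ m * n)) q = map_poly of_int Q"
proof -
  let ?F = "map_poly rat_of_int f" and ?G = "map_poly rat_of_int g"
  obtain s t where st: "pseudo_divmod v f = (s, t)" by (cases "pseudo_divmod v f")
  \<comment> \<open>The exponent of pseudo-division; the truncated subtraction makes it 0 when
    \<open>v\<close> already has degree below that of \<open>f\<close>.\<close>
  define m where "m = Suc (degree v) - degree f"
  have "f \<noteq> 0" using f by auto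
  have v: "smult (lead_coeff f ^ m) v = f * s + t" and t: "degree t < degree f"
    using pseudo_divmod[OF \<open>f \<noteq> 0\<close> st] f by (auto simp: m_def)
  \<comment> \<open>Substituting \<open>f * s + t\<close> for the scaled \<open>v\<close> produces
    \<open>f * s * g\<close>, which is moved into the coefficient of \<open>f\<close>.\<close>
  define P where "P = smult (lead_coeff f ^ m) u + s * g"
  define c where "c = lead_coeff f ^ m * n"
  have "P * f + t * g = smult (lead_coeff f ^ m) u * f + (f * s + t) * g"
    by (simp add: P_def algebra_simps)
  also have "\<dots> = smult (lead_coeff f ^ m) (u * f + v * g)"
    by (simp add: v[symmetric] smult_add_right)
  finally have "P * f + t * g = [:c:]" by (simp add: uv c_def)
  from arg_cong[OF this, of "map_poly rat_of_int"]
  have Pt: "map_poly of_int P * ?F + map_poly of_int t * ?G = [:of_int c:]"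
    by (simp add: map_poly_of_int_add map_poly_of_int_mult map_poly_pCons)
  have "map_poly of_int P - smult (of_int c) p = 0 \<and> map_poly of_int t - smult (of_int c) q = 0"
  proof (rule bezout_homogeneous_zero[OF pq(1)])
    have "smult (of_int c) p * ?F + smult (of_int c) q * ?G = [:of_int c:]"
      using arg_cong[OF pq(1), of "smult (of_int c)"] by (simp add: smult_add_right)
    then show "(map_poly of_int P - smult (of_int c) p) * ?F
        + (map_poly of_int t - smult (of_int c) q) * ?G = 0"
      using Pt by (simp add: algebra_simps)
    have "degree (smult (of_int c) q) < degree f"
      using degree_smult_le[of "of_int c" q] pq(2) by linarith
    then show "degree (map_poly of_int t - smult (of_int c) q) < degree ?F"
      using t by (simp add: degree_map_poly_of_int degree_diff_less)
  qed
  then show ?thesis unfolding c_def by (metis eq_iff_diff_eq_0)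
qed

text \<open>The least element is attained because the set is nonempty: clearing denominators in the
  Bezout identity puts the positive integer \<open>M * N\<close> into the ideal.\<close>

lemma reduced_resultant:
  assumes pq: "p * map_poly of_int f + q * map_poly of_int g = (1 :: rat poly)"
  shows "\<exists>u v. u * f + v * g = [:int (reduced_resultant f g):]"
proof -
  obtain M P where M: "M > 0" "smult (of_int M) p = map_poly of_int P" by (rule clear_denominators)
  obtain N Q where N: "N > 0" "smult (of_int N) q = map_poly of_int Q" by (rule clear_denominators)
  have "map_poly rat_of_int (smult N P * f + smult M Q * g)
      = smult (of_int N) (map_poly of_int P) * map_poly of_int f
        + smult (of_int M) (map_poly of_int Q) * map_poly of_int g"
    by (simp add: map_poly_of_int_add flip: map_poly_of_int_mult)
      (simp add: poly_eq_iff coeff_map_poly)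
  also have "\<dots> = smult (of_int (M * N)) (p * map_poly of_int f + q * map_poly of_int g)"
    by (simp add: M(2)[symmetric] N(2)[symmetric] smult_add_right mult.commute)
  also have "\<dots> = map_poly of_int [:M * N:]" by (simp add: pq map_poly_pCons)
  finally have "smult N P * f + smult M Q * g = [:int (nat (M * N)):]"
    using M(1) N(1) by (simp add: poly_eq_iff coeff_map_poly flip: of_int_mult of_int_add)
  moreover have "nat (M * N) > 0" using M(1) N(1) by simp
  ultimately have "\<exists>n > 0. \<exists>u v. u * f + v * g = [:int n:]" by blast
  from LeastI_ex[OF this] show ?thesis unfolding reduced_resultant_def by blast
qed

theorem theorem3p1:
  fixes f g :: "int poly" and d :: int
  assumes "degree f > 0" and "degree g > 0"
    and "\<not> (\<exists>z :: complex. poly (map_poly of_int f) z = 0 \<and> poly (map_poly of_int g) z = 0)"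
    and "d = gcd (lead_coeff f) (lead_coeff g)"
  shows "\<exists>k :: nat. bezout_denom f g dvd d ^ k * int (reduced_resultant f g)"
proof -
  obtain p q where pq: "bezout_pair f g = (p, q)" by (cases "bezout_pair f g")
  note bez = bezout_pair[OF assms(1-3) pq]
  define B where "B = bezout_denom f g"
  have B: "B = Lcm (denominator ` (set (coeffs p) \<union> set (coeffs q)))"
    by (simp add: B_def bezout_denom_def pq)
  define r where "r = int (reduced_resultant f g)"
  obtain u v where uv: "u * f + v * g = [:r:]"
    using bez reduced_resultant unfolding r_def by blast
  obtain m where m: "B dvd lead_coeff f ^ m * r"
    using integral_multiple_of_bezout[OF assms(1) _ _ uv, of p q] bez Lcm_denominator_dvd
    unfolding B by blast
  \<comment> \<open>The same argument with \<open>f\<close>, \<open>g\<close> and also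
    \<open>p\<close>, \<open>q\<close> exchanged; the pseudo-division is now of \<open>u\<close> by
    \<open>g\<close>.\<close>
  obtain l where l: "B dvd lead_coeff g ^ l * r"
    using integral_multiple_of_bezout[OF assms(2), of q p f v u r] uv bez Lcm_denominator_dvd[of _ p _ q]
    unfolding B by (metis add.commute)
  \<comment> \<open>A common exponent is needed so that the gcd of the two powers is the power
    \<open>d ^ k\<close>.\<close>
  define k where "k = max m l"
  have "lead_coeff f ^ m * r dvd lead_coeff f ^ k * r" "lead_coeff g ^ l * r dvd lead_coeff g ^ k * r"
    by (simp_all add: k_def le_imp_power_dvd mult_dvd_mono)
  then have "B dvd gcd (lead_coeff f ^ k * r) (lead_coeff g ^ k * r)"
    using m l by (meson dvd_trans gcd_greatest)
  \<comment> \<open>No absolute value remains around \<open>r\<close>, since it is the image of a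
    natural number.\<close>
  also have "\<dots> = gcd (lead_coeff f ^ k) (lead_coeff g ^ k) * r"
    by (simp add: gcd_mult_right abs_mult r_def gcd.commute)
  also have "\<dots> = d ^ k * r" by (simp add: assms(4))
  finally show ?thesis unfolding B_def r_def by blast
qed

end
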